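(* Let $n \ge 3$ and let $T$ be a triangulation of a convex $n$-gon with vertices labeled cyclically $1,\dots,n$. Let $(F_{i,j})$ (indexed by $i,j\in\mathbf{Z}$ with $1\le j-i\le n-1$) be the Conway–Coxeter frieze pattern of $T$. For $i\not\equiv j \pmod n$ let $m_{i,j}$ be the number of perfect matchings of the graph $G_{i,j}$ obtained from the vertex–triangle incidence graph $G(T)$ by deleting the black vertices $i$ and $j$ (subscripts interpreted mod $n$). Then the Conway–Coxeter frieze pattern of $T$ is the array of the numbers $m_{i,j}$, that is, $$F_{i,j} = m_{i,j}\qquad\text{for all } i,j\in\mathbf{Z} \text{ with } 1\le j-i\le n-1 .$$
   Context: A triangulation of a convex $n$-gon is a dissection into $n-2$ triangles by $n-3$ pairwise non-crossing diagonals joining vertices of the polygon. Conway–Coxeter frieze pattern of $T$: for a vertex $k$ let $a_k$ be the number of triangles of $T$ incident with vertex $k$, and extend $a_k$ to all $k\in\mathbf{Z}$ with period $n$. The frieze pattern is an array with $n-1$ rows; the entries of the $r$-th row ($1\le r\le n-1$) are indexed from left to right as $F_{i,i+r}$, $i\in\mathbf{Z}$, each row being offset by half a position from the preceding one so that $F_{i-1,j+1}$ lies directly below $F_{i,j}$, with $F_{i-1,j}$ and $F_{i,j+1}$ to the left and right between them. It is determined by: (1) the first row consists of 1's: $F_{i,i+1}=1$ for all $i$; (2) the second row is $\dots,a_1,a_2,\dots,a_n,a_1,\dots$: $F_{i-1,i+1}=a_i$ for all $i$; (3) each succeeding row is given by the frieze recurrence $F_{i-1,j+1} = (F_{i-1,j}F_{i,j+1}-1)/F_{i,j}$.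 (By Conway and Coxeter, the entries in rows $1$ through $n-3$ are non-zero, so the recurrence never involves division by $0$.) Graph $G=G(T)$: the bipartite graph with $n$ black vertices corresponding to the vertices of the $n$-gon and $n-2$ white vertices corresponding to the triangles of $T$; a black vertex $v$ and a white vertex $w$ are joined by an edge precisely when $v$ is one of the three vertices of the triangle corresponding to $w$. $G_{i,j}$ is obtained from $G$ by removing black vertices $i$ and $j$ and all edges incident with them. A perfect matching is a set of edges such that every vertex belongs to exactly one of them. *)

theory Defs
  imports Complex_Main
begin

text \<open>
  The vertices of the convex \<open>n\<close>-gon are the labels \<open>1, \<dots>, n\<close> in cyclic order. An arbitrary
  integer \<open>k\<close> denotes the vertex whose label is congruent to \<open>k\<close> modulo \<open>n\<close>.
\<close>

definition vertices :: "nat \<Rightarrow> int set" where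
  "vertices n = {1..int n}"

definition label :: "nat \<Rightarrow> int \<Rightarrow> int" where
  "label n k = (k - 1) mod int n + 1"

definition sides :: "nat \<Rightarrow> int set set" where
  "sides n = {{k, label n (k + 1)} | k. k \<in> vertices n}"

definition diagonals :: "nat \<Rightarrow> int set set" where
  "diagonals n = {e. e \<subseteq> vertices n \<and> card e = 2} - sides n"

text \<open>
  Two chords of a convex polygon meet in their interiors iff their endpoints are four distinct
  vertices that alternate around the polygon.
\<close>

definition crossing :: "int set \<Rightarrow> int set \<Rightarrow> bool" where
  "crossing e f \<longleftrightarrow>
     (\<exists>a b c d. a < b \<and> b < c \<and> c < d \<and>
        ((e = {a, c} \<and> f = {b, d}) \<or> (e = {b, d} \<and> f = {a, c})))"

text \<open>A triangulation is represented by its set of diagonals.\<close>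

definition triangulation :: "nat \<Rightarrow> int set set \<Rightarrow> bool" where
  "triangulation n T \<longleftrightarrow>
     T \<subseteq> diagonals n \<and> card T = n - 3 \<and> (\<forall>e\<in>T. \<forall>f\<in>T. \<not> crossing e f)"

text \<open>
  The regions of the dissection, each given by its vertex set. A triangle all of whose edges are
  sides of the polygon or diagonals of \<open>T\<close> is not subdivided further: a diagonal of \<open>T\<close> through its
  interior would cross one of its edges, because all vertices lie on the boundary of the polygon.
\<close>

definition triangles :: "nat \<Rightarrow> int set set \<Rightarrow> int set set" where
  "triangles n T =
     {t. t \<subseteq> vertices n \<and> card t = 3 \<and>
         (\<forall>u\<in>t. \<forall>v\<in>t. u \<noteq> v \<longrightarrow> {u, v} \<in> sides n \<union> T)}"

definition num_incident :: "nat \<Rightarrow> int set set \<Rightarrow> int \<Rightarrow> nat" where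
  "num_incident n T k = card {t \<in> triangles n T. label n k \<in> t}"

text \<open>
  \<open>frieze_row n T r i\<close> is the entry \<open>F\<^bsub>i,i+r\<^esub>\<close> of the \<open>r\<close>-th row. Only the rows
  \<open>1 \<le> r \<le> n - 1\<close> belong to the frieze pattern; the values in other rows are irrelevant.
\<close>

fun frieze_row :: "nat \<Rightarrow> int set set \<Rightarrow> nat \<Rightarrow> int \<Rightarrow> rat" where
  "frieze_row n T 0 i = 0"
| "frieze_row n T (Suc 0) i = 1"
| "frieze_row n T (Suc (Suc 0)) i = of_nat (num_incident n T (i + 1))"
| "frieze_row n T (Suc (Suc (Suc r))) i =
     (frieze_row n T (Suc (Suc r)) i * frieze_row n T (Suc (Suc r)) (i + 1) - 1)
       / frieze_row n T (Suc r) (i + 1)"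

definition frieze :: "nat \<Rightarrow> int set set \<Rightarrow> int \<Rightarrow> int \<Rightarrow> rat" where
  "frieze n T i j = frieze_row n T (nat (j - i)) i"

lemma frieze_first_row: "frieze n T i (i + 1) = 1"
  by (simp add: frieze_def)

lemma frieze_second_row: "frieze n T (i - 1) (i + 1) = of_nat (num_incident n T i)"
  by (simp add: frieze_def numeral_2_eq_2)

lemma frieze_recurrence:
  assumes "1 \<le> j - i"
  shows "frieze n T (i - 1) (j + 1) =
           (frieze n T (i - 1) j * frieze n T i (j + 1) - 1) / frieze n T i j"
proof -
  define r where "r = nat (j - i - 1)"
  have j: "j = i + 1 + int r"
    using assms by (simp add: r_def)
  have "nat (j - i) = Suc r" "nat (j - (i - 1)) = Suc (Suc r)"
    "nat (j + 1 - i) = Suc (Suc r)" "nat (j + 1 - (i - 1)) = Suc (Suc (Suc r))"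
    by (simp_all add: j)
  then show ?thesis
    by (simp add: frieze_def)
qed

text \<open>A graph is a pair of a vertex set and a set of edges, which are two-element vertex sets.\<close>

type_synonym 'a graph = "'a set \<times> 'a set set"

definition delete_vertices :: "'a graph \<Rightarrow> 'a set \<Rightarrow> 'a graph" where
  "delete_vertices G X = (fst G - X, {e \<in> snd G. e \<inter> X = {}})"

definition perfect_matching :: "'a graph \<Rightarrow> 'a set set \<Rightarrow> bool" where
  "perfect_matching G M \<longleftrightarrow> M \<subseteq> snd G \<and> (\<forall>v\<in>fst G. \<exists>!e. e \<in> M \<and> v \<in> e)"

text \<open>Black vertices are tagged with \<open>Inl\<close>, white vertices with \<open>Inr\<close>.\<close>

definition incidence_graph :: "nat \<Rightarrow> int set set \<Rightarrow> (int + int set) graph" where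
  "incidence_graph n T =
     (Inl ` vertices n \<union> Inr ` triangles n T,
      {{Inl v, Inr t} | v t. v \<in> vertices n \<and> t \<in> triangles n T \<and> v \<in> t})"

definition reduced_graph :: "nat \<Rightarrow> int set set \<Rightarrow> int \<Rightarrow> int \<Rightarrow> (int + int set) graph" where
  "reduced_graph n T i j =
     delete_vertices (incidence_graph n T) {Inl (label n i), Inl (label n j)}"

definition num_matchings :: "nat \<Rightarrow> int set set \<Rightarrow> int \<Rightarrow> int \<Rightarrow> nat" where
  "num_matchings n T i j = card {M. perfect_matching (reduced_graph n T i j) M}"

end

theory Submission
  imports Defs "HOL-Library.Product_Plus"
begin

text \<open>
  Assign to the vertices of the polygon plane vectors \<open>x\<close> with \<open>x w = x u + x v\<close> whenever an ear
  \<open>w\<close> is glued onto the side between \<open>u\<close> and \<open>v\<close>, starting from a unit basis for a \<open>2\<close>-gon. Expanding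
  the perfect matchings at the ear triangle shows that the matching numbers satisfy the same
  recursion, so \<open>m i j = det (x i, x j)\<close> for \<open>i < j\<close>; consecutive vectors have determinant \<open>1\<close>, and
  \<open>det (x (k - 1), x (k + 1))\<close> counts the triangles at \<open>k\<close>. Extending \<open>x\<close> antiperiodically to all
  integers turns the frieze recurrence into the Pluecker relation. Since both ends of the labelling
  are adjacent, the ear can always be chosen strictly between the least and the greatest label, as
  the vertex cut off by an innermost chord.
\<close>

section \<open>Ears of a noncrossing set of chords\<close>

text \<open>Removing ears leaves gaps in the labelling, so neighbours are taken relative to the
  surviving vertices instead of as \<open>k\<close> and \<open>k + 1\<close>. With more than two
  vertices, the closing side from least to greatest is not such a pair.\<close>

definition consecutive :: "int set \<Rightarrow> int \<Rightarrow> int \<Rightarrow> bool" where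
  "consecutive V i j \<longleftrightarrow> i \<in> V \<and> j \<in> V \<and> i < j \<and> (\<forall>z\<in>V. z \<le> i \<or> j \<le> z)"

text \<open>
  The set \<open>arcs V\<close> contains the pair of the least and the greatest vertex, although it is a side of
  the polygon: treating that side as an additional chord makes every ear lie below some chord.
\<close>

definition arcs :: "int set \<Rightarrow> (int \<times> int) set" where
  "arcs V = {(a, b). a \<in> V \<and> b \<in> V \<and> a < b \<and> V \<inter> {a<..<b} \<noteq> {}}"

definition noncrossing :: "(int \<times> int) set \<Rightarrow> bool" where
  "noncrossing C \<longleftrightarrow> (\<forall>a b c d. (a, c) \<in> C \<longrightarrow> (b, d) \<in> C \<longrightarrow> \<not> (a < b \<and> b < c \<and> c < d))"

lemma noncrossing_subset: "noncrossing C \<Longrightarrow> D \<subseteq> C \<Longrightarrow> noncrossing D"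
  unfolding noncrossing_def by blast

text \<open>Choose \<open>(u, v)\<close> with \<open>v - u\<close> minimal. No chord then ends
  strictly between \<open>u\<close> and \<open>v\<close>, so the vertices there can be cut off
  without destroying another chord.\<close>

lemma innermost_arc:
  assumes "C \<subseteq> arcs V" "noncrossing C" "C \<noteq> {}"
  obtains u v where "(u, v) \<in> C" "C - {(u, v)} \<subseteq> arcs (V - {u<..<v})"
proof -
  obtain p where p: "p \<in> C" "\<And>q. q \<in> C \<Longrightarrow> nat (snd p - fst p) \<le> nat (snd q - fst q)"
    using assms(3) ex_has_least_nat[of "\<lambda>p. p \<in> C" _ "\<lambda>p. nat (snd p - fst p)"] by blast
  obtain u v where uv: "p = (u, v)" by fastforce
  have C: "(u, v) \<in> C" using p uv by simp
  then have "u \<in> V" "v \<in> V" "u < v" using assms(1) by (auto simp: arcs_def)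
  have least: "v - u \<le> b - a" if "(a, b) \<in> C" for a b
    using p(2)[OF that] uv \<open>u < v\<close> assms(1) that by (auto simp: arcs_def)
  have "(a, b) \<in> arcs (V - {u<..<v})" if ab: "(a, b) \<in> C" "(a, b) \<noteq> (u, v)" for a b
  proof -
    have "(a, b) \<in> arcs V" using ab assms(1) by blast
    then obtain w where w: "a \<in> V" "b \<in> V" "a < b" "w \<in> V" "a < w" "w < b"
      by (auto simp: arcs_def)
    have nc: "\<not> (a < u \<and> u < b \<and> b < v)" "\<not> (u < a \<and> a < v \<and> v < b)"
      using assms(2) ab(1) C unfolding noncrossing_def by blast+
    \<comment> \<open>An endpoint strictly between \<open>u\<close> and \<open>v\<close> makes the
      chord cross \<open>(u, v)\<close> or lie inside it and be strictly shorter.\<close>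
    have out: "\<not> (u < a \<and> a < v)" "\<not> (u < b \<and> b < v)"
      using nc least[OF ab(1)] \<open>a < b\<close> by linarith+
    have "\<exists>z. z \<in> V \<and> a < z \<and> z < b \<and> \<not> (u < z \<and> z < v)"
    proof (cases "u < w \<and> w < v")
      case True
      \<comment> \<open>The vertex \<open>w\<close> below \<open>(a, b)\<close> is cut off. As the
        two chords differ, \<open>u\<close> or \<open>v\<close> lies strictly between
        \<open>a\<close> and \<open>b\<close> and replaces it.\<close>
      then have "a \<le> u" "v \<le> b" using out w by linarith+
      then show ?thesis using ab(2) \<open>u \<in> V\<close> \<open>v \<in> V\<close> \<open>u < v\<close>
        by (metis dual_order.strict_trans1 dual_order.strict_trans2 order_le_less order_less_irrefl)
    qed (use w in blast)
    then show ?thesis using w out by (auto simp: arcs_def)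
  qed
  then have "C - {(u, v)} \<subseteq> arcs (V - {u<..<v})" by auto
  then show thesis using that[OF C] by blast
qed

text \<open>Cutting below an innermost chord costs one chord and at least one vertex, while both its
  endpoints survive. The bound is one above the usual number of diagonals because the extreme pair
  may count as a chord.\<close>

lemma card_noncrossing_arcs:
  assumes "finite V" "2 \<le> card V" "C \<subseteq> arcs V" "noncrossing C"
  shows "finite C \<and> card C + 2 \<le> card V"
  using assms
proof (induction "card V" arbitrary: V C rule: less_induct)
  case less
  show ?case
  proof (cases "C = {}")
    case False
    obtain u v where uv: "(u, v) \<in> C" "C - {(u, v)} \<subseteq> arcs (V - {u<..<v})"
      using innermost_arc less.prems False by blast
    then have V: "u \<in> V" "v \<in> V" "u < v" "V \<inter> {u<..<v} \<noteq> {}"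
      using less.prems by (auto simp: arcs_def)
    have lt: "card (V - {u<..<v}) < card V"
      using V(4) less.prems(1) by (intro psubset_card_mono) auto
    have "card {u, v} \<le> card (V - {u<..<v})"
      using V less.prems(1) by (intro card_mono) auto
    then have "2 \<le> card (V - {u<..<v})" using V(3) by simp
    then have "finite (C - {(u, v)}) \<and> card (C - {(u, v)}) + 2 \<le> card (V - {u<..<v})"
      using less.prems less.hyps[OF lt] uv noncrossing_subset[of C] by (meson Diff_subset finite_Diff)
    moreover have "card C = Suc (card (C - {(u, v)}))"
      using calculation uv(1) by (intro card.remove) auto
    ultimately show ?thesis using lt by simp
  qed (use less in simp)
qed

text \<open>The counting bound still holds after the cut; since \<open>C\<close> attains it before
  the cut, only a single vertex can have been lost.\<close>

lemma ear_exists: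
  assumes "finite V" "C \<subseteq> arcs V" "noncrossing C" "C \<noteq> {}" "card C + 2 = card V"
  obtains u v w where "(u, v) \<in> C" "V \<inter> {u<..<v} = {w}" "C - {(u, v)} \<subseteq> arcs (V - {w})"
proof -
  obtain u v where uv: "(u, v) \<in> C" "C - {(u, v)} \<subseteq> arcs (V - {u<..<v})"
    using innermost_arc assms by blast
  then have V: "u \<in> V" "v \<in> V" "u < v" "V \<inter> {u<..<v} \<noteq> {}"
    using assms by (auto simp: arcs_def)
  have "card {u, v} \<le> card (V - {u<..<v})"
    using V assms(1) by (intro card_mono) auto
  then have "2 \<le> card (V - {u<..<v})" using V(3) by simp
  then have "finite (C - {(u, v)}) \<and> card (C - {(u, v)}) + 2 \<le> card (V - {u<..<v})"
    using assms uv noncrossing_subset[of C] by (intro card_noncrossing_arcs) auto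
  moreover have "card V = card (V - {u<..<v}) + card (V \<inter> {u<..<v})"
    using assms(1) by (metis add.commute card_Int_Diff)
  moreover have "card (V \<inter> {u<..<v}) > 0" using V(4) assms(1) by (simp add: card_gt_0_iff)
  moreover have "card C = Suc (card (C - {(u, v)}))"
    using calculation(1) uv(1) by (intro card.remove) auto
  ultimately have "card (V \<inter> {u<..<v}) = 1" using assms(5) by linarith
  then obtain w where w: "V \<inter> {u<..<v} = {w}" by (meson card_1_singletonE)
  have "V - {u<..<v} = V - {w}" using w by blast
  then show thesis using that uv w by simp
qed

text \<open>The start is a degenerate 2-gon without triangles. New vertices go strictly between
  neighbours, so \<open>a\<close> and \<open>b\<close> remain the extreme labels and can be fixed
  parameters.\<close>

inductive ear_built :: "int \<Rightarrow> int \<Rightarrow> int set \<Rightarrow> int set set \<Rightarrow> bool" for a b where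
  base: "a < b \<Longrightarrow> ear_built a b {a, b} {}"
| ear: "ear_built a b V S \<Longrightarrow> consecutive V u v \<Longrightarrow> u < w \<Longrightarrow> w < v \<Longrightarrow>
    ear_built a b (insert w V) (insert {u, w, v} S)"

definition arc_edges :: "int set \<Rightarrow> (int \<times> int) set \<Rightarrow> int set set" where
  "arc_edges V C = {{i, j} | i j. (i, j) \<in> C \<or> consecutive V i j}"

text \<open>This generalizes \<open>triangles\<close> to any vertex and edge set, so that it applies
  to the smaller polygons left after removing ears.\<close>

definition cliques3 :: "int set \<Rightarrow> int set set \<Rightarrow> int set set" where
  "cliques3 V E = {t. t \<subseteq> V \<and> card t = 3 \<and> (\<forall>u\<in>t. \<forall>v\<in>t. u \<noteq> v \<longrightarrow> {u, v} \<in> E)}"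

text \<open>The chord \<open>(u, v)\<close> leaves \<open>C\<close>, but its edge survives because
  \<open>u\<close> and \<open>v\<close> become neighbours once \<open>w\<close> is gone. Only the
  two sides at \<open>w\<close> disappear.\<close>

lemma arc_edges_ear:
  assumes "C \<subseteq> arcs V" "(u, v) \<in> C" "V \<inter> {u<..<v} = {w}" "C - {(u, v)} \<subseteq> arcs (V - {w})"
  shows "arc_edges V C = arc_edges (V - {w}) (C - {(u, v)}) \<union> {{u, w}, {w, v}}"
    and "consecutive (V - {w}) u v"
proof -
  have V: "u \<in> V" "v \<in> V" "u < w" "w < v" "w \<in> V"
    using assms by (auto simp: arcs_def)
  have sep: "z \<le> u \<or> z = w \<or> v \<le> z" if "z \<in> V" for z
  proof -
    have "z = w" if "u < z" "z < v"
      using assms(3) that \<open>z \<in> V\<close> by (metis IntI greaterThanLessThan_iff singletonD)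
    then show ?thesis by force
  qed
  show uv: "consecutive (V - {w}) u v"
    using V sep unfolding consecutive_def by auto
  have uw: "consecutive V u w" and wv: "consecutive V w v"
    using V sep unfolding consecutive_def by force+
  have 1: "(i, j) \<in> C - {(u, v)} \<or> consecutive (V - {w}) i j \<or> (i, j) \<in> {(u, w), (w, v)}"
    if "(i, j) \<in> C \<or> consecutive V i j" for i j
  proof (cases "(i, j) \<in> C")
    case True
    then show ?thesis using uv by auto
  next
    case False
    then have c: "consecutive V i j" using that by simp
    then have ij: "i \<in> V" "j \<in> V" "i < j" "\<And>z. z \<in> V \<Longrightarrow> z \<le> i \<or> j \<le> z"
      unfolding consecutive_def by blast+
    show ?thesis
    proof (cases "i = w \<or> j = w")
      case True
      have "j = v" if "i = w"
        using that ij(3) ij(4)[OF V(2)] sep[OF ij(2)] V(3,4) by linarith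
      moreover have "i = u" if "j = w"
        using that ij(3) ij(4)[OF V(1)] sep[OF ij(1)] V(3,4) by linarith
      ultimately show ?thesis using True by auto
    next
      case False
      then show ?thesis using c unfolding consecutive_def by auto
    qed
  qed
  have 2: "(i, j) \<in> C \<or> consecutive V i j" if "consecutive (V - {w}) i j" for i j
  proof (cases "i < w \<and> w < j")
    case True
    then have "i = u" "j = v"
      using that V sep[of i] sep[of j] unfolding consecutive_def by force+
    then show ?thesis using assms(2) by simp
  next
    case False
    then show ?thesis using that unfolding consecutive_def by auto
  qed
  show "arc_edges V C = arc_edges (V - {w}) (C - {(u, v)}) \<union> {{u, w}, {w, v}}"
  proof
    show "arc_edges V C \<subseteq> arc_edges (V - {w}) (C - {(u, v)}) \<union> {{u, w}, {w, v}}"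
      unfolding arc_edges_def using 1 by blast
    show "arc_edges (V - {w}) (C - {(u, v)}) \<union> {{u, w}, {w, v}} \<subseteq> arc_edges V C"
      unfolding arc_edges_def using 2 uw wv by blast
  qed
qed

text \<open>The only edges at \<open>w\<close> lead to \<open>u\<close> and \<open>v\<close>, so a
  triangle through \<open>w\<close> has no other choice of vertices; triangles avoiding
  \<open>w\<close> use edges of \<open>E\<close> alone.\<close>

lemma cliques3_ear:
  assumes E: "\<And>e. e \<in> E \<Longrightarrow> w \<notin> e" "{u, v} \<in> E" and d: "u \<noteq> w" "v \<noteq> w" "u \<noteq> v"
    and V: "u \<in> V" "v \<in> V" "w \<notin> V"
  shows "cliques3 (insert w V) (E \<union> {{u, w}, {w, v}}) = insert {u, w, v} (cliques3 V E)"
    (is "?L = ?R")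
proof (intro equalityI subsetI)
  fix t assume "t \<in> ?L"
  then have t: "t \<subseteq> insert w V" "card t = 3"
    "\<And>p q. p \<in> t \<Longrightarrow> q \<in> t \<Longrightarrow> p \<noteq> q \<Longrightarrow> {p, q} \<in> E \<union> {{u, w}, {w, v}}"
    by (auto simp: cliques3_def)
  show "t \<in> ?R"
  proof (cases "w \<in> t")
    case True
    have "p = u \<or> p = v" if "p \<in> t" "p \<noteq> w" for p
      using t(3)[OF True that(1)] that(2) E(1)[of "{w, p}"] by (auto simp: doubleton_eq_iff)
    then have "t \<subseteq> {u, w, v}" by blast
    moreover have "card {u, w, v} = 3" using d by auto
    ultimately have "t = {u, w, v}" using t(2) by (metis card_subset_eq finite.emptyI finite.insertI)
    then show ?thesis by simp
  next
    case False
    then have "{p, q} \<in> E" if "p \<in> t" "q \<in> t" "p \<noteq> q" for p q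
      using t(3)[OF that] that by (auto simp: doubleton_eq_iff)
    then show ?thesis using False t(1,2) unfolding cliques3_def by blast
  qed
next
  fix t assume "t \<in> ?R"
  then show "t \<in> ?L"
  proof
    assume "t = {u, w, v}"
    moreover have "{v, u} \<in> E" using E(2) by (simp add: insert_commute)
    ultimately show ?thesis using E(2) d V unfolding cliques3_def
      by (auto simp: doubleton_eq_iff)
  qed (auto simp: cliques3_def)
qed

lemma ear_built_cliques3:
  assumes "finite V" "C \<subseteq> arcs V" "noncrossing C" "card C + 2 = card V"
    "a \<in> V" "b \<in> V" "a < b" "V \<subseteq> {a..b}"
  shows "ear_built a b V (cliques3 V (arc_edges V C))"
  using assms
proof (induction "card V" arbitrary: V C rule: less_induct)
  case less
  have ab: "{a, b} \<subseteq> V" "card {a, b} = 2" using less.prems by auto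
  show ?case
  proof (cases "C = {}")
    case True
    then have V: "{a, b} = V" using less.prems ab by (intro card_subset_eq) auto
    have "\<not> card t = 3" if "t \<subseteq> V" for t
      using card_mono[OF \<open>finite V\<close> that] V ab(2) by auto
    then have "cliques3 V (arc_edges V C) = {}" by (auto simp: cliques3_def)
    then show ?thesis using V ear_built.base[OF \<open>a < b\<close>] by simp
  next
    case False
    obtain u v w where uvw: "(u, v) \<in> C" "V \<inter> {u<..<v} = {w}" "C - {(u, v)} \<subseteq> arcs (V - {w})"
      using ear_exists less.prems False by metis
    note ed = arc_edges_ear[OF \<open>C \<subseteq> arcs V\<close> uvw]
    have V: "u \<in> V" "v \<in> V" "u < w" "w < v" "w \<in> V"
      using uvw less.prems(2) by (auto simp: arcs_def)
    define V' C' where "V' = V - {w}" and "C' = C - {(u, v)}"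
    have ins: "V = insert w V'" using V V'_def by auto
    have "2 \<le> card V" using card_mono[OF \<open>finite V\<close> ab(1)] ab(2) by simp
    then have "finite C" using card_noncrossing_arcs less.prems by blast
    then have "card C = Suc (card C')" "card V = Suc (card V')"
      unfolding V'_def C'_def using uvw(1) V(5) \<open>finite V\<close> by (intro card.remove; simp)+
    then have "card C' + 2 = card V'" "card V' < card V" using less.prems(4) by auto
    \<comment> \<open>Hence \<open>w\<close>, strictly between \<open>u\<close> and
      \<open>v\<close>, is neither \<open>a\<close> nor \<open>b\<close>, and both extremes survive
      for the induction.\<close>
    moreover have "u \<in> {a..b}" "v \<in> {a..b}" using V less.prems by auto
    ultimately have ih: "ear_built a b V' (cliques3 V' (arc_edges V' C'))"
      using less.prems V uvw noncrossing_subset[of C C']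
      by (intro less.hyps) (auto simp: V'_def C'_def)
    have eq: "cliques3 V (arc_edges V C) = insert {u, w, v} (cliques3 V' (arc_edges V' C'))"
      unfolding ed(1) V'_def[symmetric] C'_def[symmetric] unfolding ins
    proof (rule cliques3_ear)
      show "w \<notin> e" if "e \<in> arc_edges V' C'" for e
        using that uvw(3) V unfolding arc_edges_def V'_def C'_def consecutive_def arcs_def by auto
      show "{u, v} \<in> arc_edges V' C'"
        using ed(2) unfolding arc_edges_def V'_def by blast
    qed (use V V'_def in auto)
    have "consecutive V' u v" using ed(2) V'_def by simp
    from ear_built.ear[OF ih this V(3,4)] show ?thesis unfolding eq ins[symmetric] .
  qed
qed

lemma ear_built_props:
  assumes "ear_built a b V S"
  shows "finite V \<and> finite S \<and> \<Union>S \<subseteq> V \<and> a \<in> V \<and> b \<in> V \<and> a < b \<and> V \<subseteq> {a..b}"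
  using assms
  by (induction rule: ear_built.induct) (auto simp: consecutive_def)

section \<open>Matchings between vertices and triangles\<close>

text \<open>Deleted black vertices are modelled by shrinking \<open>B\<close>. Removing a triangle
  together with its partner thus yields an instance of the same notion.\<close>

definition matchings :: "int set \<Rightarrow> int set set \<Rightarrow> (int \<times> int set) set set" where
  "matchings B S = {R. R \<subseteq> {(v, t). v \<in> B \<and> t \<in> S \<and> v \<in> t} \<and>
     (\<forall>v\<in>B. \<exists>!t. (v, t) \<in> R) \<and> (\<forall>t\<in>S. \<exists>!v. (v, t) \<in> R)}"

lemma matchingsD:
  assumes "R \<in> matchings B S"
  shows "R \<subseteq> {(v, t). v \<in> B \<and> t \<in> S \<and> v \<in> t}"
    and "v \<in> B \<Longrightarrow> \<exists>!t. (v, t) \<in> R" and "t \<in> S \<Longrightarrow> \<exists>!v. (v, t) \<in> R"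
  using assms by (simp_all add: matchings_def)

lemma finite_matchings: "finite B \<Longrightarrow> finite S \<Longrightarrow> finite (matchings B S)"
  by (rule finite_subset[of _ "Pow (B \<times> S)"]) (auto simp: matchings_def)

lemma matchings_isolated:
  assumes "w \<in> B" "w \<notin> \<Union>S"
  shows "matchings B S = {}"
proof (rule equals0I)
  fix R assume "R \<in> matchings B S"
  note R = matchingsD[OF this]
  obtain t where "(w, t) \<in> R" using R(2)[OF assms(1)] by auto
  then show False using R(1) assms(2) by auto
qed

lemma matchings_insert:
  assumes "t \<notin> S"
  shows "matchings B (insert t S) = (\<Union>s\<in>t \<inter> B. insert (s, t) ` matchings (B - {s}) S)"
    (is "?L = ?R")
proof (intro equalityI subsetI)
  fix R assume "R \<in> ?L"
  note R = matchingsD[OF this]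
  obtain s where s: "(s, t) \<in> R" using R(3)[of t] by auto
  have un1: "v = s" if "(v, t) \<in> R" for v
    using R(3)[of t] that s by (metis insertI1)
  have "s \<in> t \<inter> B" using R(1) s by auto
  then have un2: "t' = t" if "(s, t') \<in> R" for t'
    using R(2)[of s] s that \<open>s \<in> t \<inter> B\<close> by (metis IntE)
  have "R - {(s, t)} \<in> matchings (B - {s}) S"
    unfolding matchings_def mem_Collect_eq
  proof (intro conjI ballI)
    show "R - {(s, t)} \<subseteq> {(v, t). v \<in> B - {s} \<and> t \<in> S \<and> v \<in> t}"
      using R(1) un1 un2 by blast
    show "\<exists>!t'. (v, t') \<in> R - {(s, t)}" if "v \<in> B - {s}" for v
      using R(2)[of v] that by auto
    show "\<exists>!v. (v, t') \<in> R - {(s, t)}" if "t' \<in> S" for t'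
      using R(3)[of t'] that assms by auto
  qed
  moreover have "R = insert (s, t) (R - {(s, t)})" using s by blast
  ultimately show "R \<in> ?R" using \<open>s \<in> t \<inter> B\<close> by blast
next
  fix R assume "R \<in> ?R"
  then obtain s R' where s: "s \<in> t" "s \<in> B" "R = insert (s, t) R'" "R' \<in> matchings (B - {s}) S"
    by blast
  note R = matchingsD[OF s(4)]
  show "R \<in> ?L"
    unfolding matchings_def mem_Collect_eq
  proof (intro conjI ballI)
    show "R \<subseteq> {(v, t'). v \<in> B \<and> t' \<in> insert t S \<and> v \<in> t'}" using R(1) s(1-3) by auto
    show "\<exists>!t'. (v, t') \<in> R" if "v \<in> B" for v
    proof (cases "v = s")
      case True
      then show ?thesis using s(3) R(1) by auto
    next
      case False
      then show ?thesis using s(3) R(2)[of v] that by auto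
    qed
    show "\<exists>!v. (v, t') \<in> R" if "t' \<in> insert t S" for t'
    proof (cases "t' = t")
      case True
      then show ?thesis using s(3) R(1) assms by auto
    next
      case False
      then show ?thesis using s(3) R(3)[of t'] that by auto
    qed
  qed
qed

lemma card_matchings_insert:
  assumes "finite B" "finite S" "t \<notin> S"
  shows "card (matchings B (insert t S)) = (\<Sum>s\<in>t \<inter> B. card (matchings (B - {s}) S))"
proof -
  \<comment> \<open>As \<open>t\<close> is new to \<open>S\<close>, it occurs in no smaller
    matching. This gives both disjointness over \<open>s\<close> and injectivity of adding the
    pair.\<close>
  have no: "(s, t) \<notin> R" if "R \<in> matchings B' S" for s R B'
    using that assms(3) unfolding matchings_def by blast
  have "card (matchings B (insert t S))
      = (\<Sum>s\<in>t \<inter> B. card (insert (s, t) ` matchings (B - {s}) S))"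
    unfolding matchings_insert[OF assms(3)]
  proof (rule card_UN_disjoint)
    show "\<forall>s\<in>t \<inter> B. \<forall>s'\<in>t \<inter> B. s \<noteq> s' \<longrightarrow>
        insert (s, t) ` matchings (B - {s}) S \<inter> insert (s', t) ` matchings (B - {s'}) S = {}"
      using no by blast
  qed (use assms finite_matchings in auto)
  also have "\<dots> = (\<Sum>s\<in>t \<inter> B. card (matchings (B - {s}) S))"
  proof (intro sum.cong refl card_image)
    show "inj_on (insert (s, t)) (matchings (B - {s}) S)" for s
      unfolding inj_on_def using no by (metis insert_ident)
  qed
  finally show ?thesis .
qed

section \<open>Matching relations and perfect matchings of the bipartite graph\<close>

lemma ex1_image:
  assumes "inj f"
  shows "(\<exists>!y. y \<in> f ` A \<and> P y) \<longleftrightarrow> (\<exists>!x. x \<in> A \<and> P (f x))"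
proof
  assume ex1: "\<exists>!y. y \<in> f ` A \<and> P y"
  then obtain y where y: "y \<in> f ` A" "P y" by (elim ex1E conjE)
  have un: "z = y" if "z \<in> f ` A" "P z" for z
    using ex1 y that by (elim ex1E) metis
  from y obtain x where x: "x \<in> A" "y = f x" by blast
  show "\<exists>!x. x \<in> A \<and> P (f x)"
  proof (rule ex1I[of _ x])
    fix z assume "z \<in> A \<and> P (f z)"
    then have "f z = f x" using un[of "f z"] x by simp
    then show "z = x" using assms by (simp add: inj_eq)
  qed (use x y in simp)
next
  assume ex1: "\<exists>!x. x \<in> A \<and> P (f x)"
  then obtain x where x: "x \<in> A" "P (f x)" by (elim ex1E conjE)
  have un: "z = x" if "z \<in> A" "P (f z)" for z
    using ex1 x that by (elim ex1E) metis
  show "\<exists>!y. y \<in> f ` A \<and> P y"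
  proof (rule ex1I[of _ "f x"])
    fix y assume "y \<in> f ` A \<and> P y"
    then obtain z where "z \<in> A" "y = f z" "P (f z)" by auto
    then show "y = f x" using un[of z] by simp
  qed (use x in simp)
qed

text \<open>The tags tell the two ends of an edge apart, so \<open>h\<close> is injective. Taking
  images under \<open>h\<close> is then a bijection that carries one uniqueness condition to the
  other.\<close>

lemma card_perfect_matchings:
  fixes B :: "int set" and S :: "int set set"
  shows "card {M. perfect_matching (Inl ` B \<union> Inr ` S,
      {{Inl v, Inr t} | v t. v \<in> B \<and> t \<in> S \<and> v \<in> t}) M} = card (matchings B S)"
proof -
  define h :: "int \<times> int set \<Rightarrow> (int + int set) set" where "h = (\<lambda>(v, t). {Inl v, Inr t})"
  have h: "h (v, t) = {Inl v, Inr t}" for v t by (simp add: h_def)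
  have inj: "inj h" by (auto simp: inj_def h_def doubleton_eq_iff)
  define P where "P = {(v, t). v \<in> B \<and> t \<in> S \<and> v \<in> t}"
  have edges: "{{Inl v, Inr t} | v t. v \<in> B \<and> t \<in> S \<and> v \<in> t} = h ` P"
    by (auto simp: P_def h_def image_def)
  have hl: "Inl v' \<in> h (v, t) \<longleftrightarrow> v' = v" and hr: "Inr t' \<in> h (v, t) \<longleftrightarrow> t' = t" for v v' t t'
    by (auto simp: h)
  note ex1 = ex1_image[OF inj]
  have mv: "(\<exists>!e. e \<in> h ` R \<and> Inl v \<in> e) \<longleftrightarrow> (\<exists>!t. (v, t) \<in> R)" for R v
    unfolding ex1 Ex1_def split_paired_Ex split_paired_All hl by simp
  have mt: "(\<exists>!e. e \<in> h ` R \<and> Inr t \<in> e) \<longleftrightarrow> (\<exists>!v. (v, t) \<in> R)" for R t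
    unfolding ex1 Ex1_def split_paired_Ex split_paired_All hr by simp
  have "{M. perfect_matching (Inl ` B \<union> Inr ` S, h ` P) M} = image h ` matchings B S"
  proof (intro equalityI subsetI)
    fix M assume "M \<in> {M. perfect_matching (Inl ` B \<union> Inr ` S, h ` P) M}"
    then have M: "M \<subseteq> h ` P" "\<forall>x\<in>Inl ` B \<union> Inr ` S. \<exists>!e. e \<in> M \<and> x \<in> e"
      by (auto simp: perfect_matching_def)
    then obtain R where R: "R \<subseteq> P" "M = h ` R" by (meson subset_imageE)
    have "\<exists>!t. (v, t) \<in> R" if "v \<in> B" for v
      using bspec[OF M(2), of "Inl v"] that mv[of R v] by (simp add: R(2))
    moreover have "\<exists>!v. (v, t) \<in> R" if "t \<in> S" for t
      using bspec[OF M(2), of "Inr t"] that mt[of R t] by (simp add: R(2))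
    ultimately have "R \<in> matchings B S"
      using R(1) unfolding matchings_def P_def by simp
    then show "M \<in> image h ` matchings B S" using R by blast
  next
    fix M assume "M \<in> image h ` matchings B S"
    then obtain R where R: "R \<in> matchings B S" "M = h ` R" by blast
    then show "M \<in> {M. perfect_matching (Inl ` B \<union> Inr ` S, h ` P) M}"
      using mv[of R] mt[of R] image_mono[of R P h]
      by (simp add: ball_Un matchings_def P_def perfect_matching_def)
  qed
  moreover have "inj_on (image h) (matchings B S)"
    using inj by (simp add: inj_on_def inj_image_eq_iff)
  ultimately show ?thesis unfolding edges by (simp add: card_image)
qed

section \<open>Vectors along an ear decomposition\<close>

lemma consecutive_insert:
  assumes "consecutive V u v" "u < w" "w < v"
  shows "consecutive (insert w V) i j \<longleftrightarrow>
    (i, j) = (u, w) \<or> (i, j) = (w, v) \<or> (consecutive V i j \<and> (i, j) \<noteq> (u, v))"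
proof -
  have uv: "u \<in> V" "v \<in> V" and sep: "\<And>z. z \<in> V \<Longrightarrow> z \<le> u \<or> v \<le> z"
    using assms(1) by (auto simp: consecutive_def)
  have "w \<notin> V" using sep assms(2,3) by force
  show ?thesis
  proof
    assume c: "consecutive (insert w V) i j"
    then have cw: "w \<le> i \<or> j \<le> w" and cV: "\<And>z. z \<in> V \<Longrightarrow> z \<le> i \<or> j \<le> z"
      and ij: "i \<in> insert w V" "j \<in> insert w V" "i < j"
      by (auto simp: consecutive_def)
    have "j = v" if "i = w"
      using that ij cV[OF uv(2)] sep[of j] assms(2,3) by auto
    moreover have "i = u" if "j = w"
      using that ij cV[OF uv(1)] sep[of i] assms(2,3) by auto
    moreover have "consecutive V i j \<and> (i, j) \<noteq> (u, v)" if "i \<noteq> w" "j \<noteq> w"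
      using that ij cV cw assms(2,3) by (auto simp: consecutive_def)
    ultimately show "(i, j) = (u, w) \<or> (i, j) = (w, v) \<or> (consecutive V i j \<and> (i, j) \<noteq> (u, v))"
      by auto
  next
    assume "(i, j) = (u, w) \<or> (i, j) = (w, v) \<or> (consecutive V i j \<and> (i, j) \<noteq> (u, v))"
    then consider "i = u" "j = w" | "i = w" "j = v" | "consecutive V i j" "(i, j) \<noteq> (u, v)"
      by blast
    then show "consecutive (insert w V) i j"
    proof cases
      case 3
      then have ij: "i \<in> V" "j \<in> V" "i < j" and cV: "\<And>z. z \<in> V \<Longrightarrow> z \<le> i \<or> j \<le> z"
        by (auto simp: consecutive_def)
      \<comment> \<open>Neighbours straddling \<open>w\<close> would bound the gap containing
        \<open>w\<close>, and hence be the excluded pair \<open>(u, v)\<close>.\<close>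
      have "w \<le> i \<or> j \<le> w"
      proof (rule ccontr)
        assume "\<not> ?thesis"
        then have "i = u" "j = v"
          using sep[OF ij(1)] sep[OF ij(2)] cV[OF uv(1)] cV[OF uv(2)] assms(2,3) by linarith+
        then show False using 3 by simp
      qed
      then show ?thesis using ij cV by (auto simp: consecutive_def)
    qed (use uv sep assms in \<open>force simp: consecutive_def\<close>)+
  qed
qed

lemma consecutive_unique:
  "consecutive V i j \<Longrightarrow> consecutive V i k \<Longrightarrow> j = k"
  "consecutive V j i \<Longrightarrow> consecutive V k i \<Longrightarrow> j = k"
  unfolding consecutive_def by force+

text \<open>The vertex \<open>w\<close> lies in the new triangle only, so these two must be matched
  and the old problem remains.\<close>

lemma card_matchings_ear_old:
  assumes "finite V" "finite S" "\<Union>S \<subseteq> V" "w \<notin> V" "i \<in> V" "j \<in> V"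
  shows "card (matchings (insert w V - {i, j}) (insert {u, w, v} S)) = card (matchings (V - {i, j}) S)"
proof -
  let ?B = "insert w V - {i, j}" and ?t = "{u, w, v}"
  have w: "w \<in> ?B" "w \<notin> \<Union>S" "?t \<notin> S" using assms by auto
  have "card (matchings ?B (insert ?t S)) = (\<Sum>s\<in>?t \<inter> ?B. card (matchings (?B - {s}) S))"
    using assms w by (intro card_matchings_insert) auto
  \<comment> \<open>Any other partner of the new triangle leaves \<open>w\<close> without a
    triangle, so its summand is zero.\<close>
  also have "\<dots> = (\<Sum>s\<in>{w}. card (matchings (?B - {s}) S))"
    using w by (intro sum.mono_neutral_right) (auto simp: matchings_isolated[of w])
  finally show ?thesis using assms by (simp add: insert_Diff_if)
qed

text \<open>With \<open>w\<close> deleted, the new triangle takes \<open>u\<close> or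
  \<open>v\<close>, which becomes the second deleted vertex of the old problem. The value 0 for an
  already deleted partner agrees with \<open>det2_self\<close>.\<close>

lemma card_matchings_ear_new:
  assumes "finite V" "finite S" "\<Union>S \<subseteq> V" "w \<notin> V" "i \<in> V" "u \<in> V" "v \<in> V" "u \<noteq> v"
  shows "card (matchings (insert w V - {i, w}) (insert {u, w, v} S)) =
    (if i = u then 0 else card (matchings (V - {i, u}) S)) +
    (if i = v then 0 else card (matchings (V - {i, v}) S))"
proof -
  let ?t = "{u, w, v}"
  have B: "insert w V - {i, w} = V - {i}" and t: "?t \<inter> (V - {i}) = {u, v} - {i}"
    using assms by auto
  have "?t \<notin> S" using assms by auto
  then have "card (matchings (V - {i}) (insert ?t S)) = (\<Sum>s\<in>{u, v} - {i}. card (matchings (V - {i, s}) S))"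
    using assms by (subst card_matchings_insert) (simp_all add: t Diff_insert2[symmetric])
  also have "\<dots> = (\<Sum>s\<in>{u, v}. if i = s then 0 else card (matchings (V - {i, s}) S))"
    by (intro sum.mono_neutral_cong_left) auto
  finally show ?thesis using assms(8) unfolding B by simp
qed

section \<open>Plane determinants and triangle counts\<close>

definition det2 :: "int \<times> int \<Rightarrow> int \<times> int \<Rightarrow> int" where
  "det2 p q = fst p * snd q - fst q * snd p"

lemma det2_add: "det2 p (q + r) = det2 p q + det2 p r" "det2 (q + r) p = det2 q p + det2 r p"
  by (simp_all add: det2_def algebra_simps)

lemma det2_self: "det2 p p = 0"
  by (simp add: det2_def)

text \<open>When \<open>det2 p q\<close> and \<open>det2 r s\<close> are both 1, this is the frieze
  recurrence without division.\<close>

lemma det2_pluecker: "det2 p r * det2 q s = det2 p q * det2 r s + det2 p s * det2 q r"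
  by (simp add: det2_def algebra_simps)

definition degree_in :: "int set set \<Rightarrow> int \<Rightarrow> nat" where
  "degree_in S k = card {t \<in> S. k \<in> t}"

lemma degree_in_insert:
  assumes "finite S" "t \<notin> S"
  shows "degree_in (insert t S) k = degree_in S k + (if k \<in> t then 1 else 0)"
proof -
  have "{t' \<in> insert t S. k \<in> t'} = (if k \<in> t then insert t {t \<in> S. k \<in> t} else {t \<in> S. k \<in> t})"
    by auto
  then show ?thesis using assms by (auto simp: degree_in_def)
qed

lemma degree_in_isolated: "k \<notin> \<Union>S \<Longrightarrow> degree_in S k = 0"
  unfolding degree_in_def by (metis (mono_tags, lifting) UnionI card.empty empty_Collect_eq)

text \<open>
  The last two conditions are the triangle counts at the extreme vertices \<open>a\<close> and \<open>b\<close>, which are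
  neighbours on the polygon; the wrap-around reverses the order of the arguments of \<open>det2\<close>.
\<close>

definition frieze_vectors ::
  "int \<Rightarrow> int \<Rightarrow> int set \<Rightarrow> int set set \<Rightarrow> (int \<Rightarrow> int \<times> int) \<Rightarrow> bool" where
  "frieze_vectors a b V S x \<longleftrightarrow>
    (\<forall>i\<in>V. \<forall>j\<in>V. i < j \<longrightarrow>
      0 < det2 (x i) (x j) \<and> int (card (matchings (V - {i, j}) S)) = det2 (x i) (x j)) \<and>
    (\<forall>i j. consecutive V i j \<longrightarrow> det2 (x i) (x j) = 1) \<and>
    det2 (x a) (x b) = 1 \<and>
    (\<forall>i j k. consecutive V i j \<longrightarrow> consecutive V j k \<longrightarrow> det2 (x i) (x k) = int (degree_in S j)) \<and>
    (\<forall>k. consecutive V a k \<longrightarrow> det2 (x k) (x b) = int (degree_in S a)) \<and>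
    (\<forall>k. consecutive V k b \<longrightarrow> det2 (x a) (x k) = int (degree_in S b))"

text \<open>Matching numbers and determinants split alike along \<open>x w = x u + x v\<close>.
  Replacing the neighbour \<open>v\<close> of \<open>u\<close> by \<open>w\<close> adds to the
  determinant across \<open>u\<close> that of \<open>u\<close> with its other neighbour; this is 1
  and accounts for the new triangle at \<open>u\<close>. The situation at \<open>v\<close> is
  symmetric.\<close>

lemma frieze_vectors_ear:
  assumes eb: "ear_built a b V S" and c: "consecutive V u v" and w: "u < w" "w < v"
    and fv: "frieze_vectors a b V S x"
  shows "frieze_vectors a b (insert w V) (insert {u, w, v} S) (x(w := x u + x v))"
proof -
  have V: "finite V" "finite S" "\<Union>S \<subseteq> V" "a \<in> V" "b \<in> V" "a < b" "V \<subseteq> {a..b}"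
    using ear_built_props[OF eb] by blast+
  have uv: "u \<in> V" "v \<in> V" "u < v" and sep: "\<And>z. z \<in> V \<Longrightarrow> z \<le> u \<or> v \<le> z"
    using c by (auto simp: consecutive_def)
  have wV: "w \<notin> V" using sep w by force
  then have tS: "{u, w, v} \<notin> S" and wS: "w \<notin> \<Union>S" using V(3) by auto
  have pos: "0 < det2 (x i) (x j)" and match: "int (card (matchings (V - {i, j}) S)) = det2 (x i) (x j)"
    if "i \<in> V" "j \<in> V" "i < j" for i j
    using fv that by (simp_all add: frieze_vectors_def)
  have one: "det2 (x i) (x j) = 1" if "consecutive V i j" for i j
    using fv that by (simp add: frieze_vectors_def)
  have ab: "det2 (x a) (x b) = 1" using fv by (simp add: frieze_vectors_def)
  have deg: "det2 (x i) (x k) = int (degree_in S j)" if "consecutive V i j" "consecutive V j k" for i j k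
    using fv that by (simp add: frieze_vectors_def)
  have deg_a: "det2 (x k) (x b) = int (degree_in S a)" if "consecutive V a k" for k
    using fv that by (simp add: frieze_vectors_def)
  have deg_b: "det2 (x a) (x k) = int (degree_in S b)" if "consecutive V k b" for k
    using fv that by (simp add: frieze_vectors_def)
  define y where "y = x(w := x u + x v)"
  have yw: "y w = x u + x v" and yV: "\<And>i. i \<noteq> w \<Longrightarrow> y i = x i" by (simp_all add: y_def)
  note cons = consecutive_insert[OF c w]
  have cV: "i \<in> V" "j \<in> V" "i \<noteq> w" "j \<noteq> w" if "consecutive V i j" for i j
    using that wV by (auto simp: consecutive_def)
  have aw: "a \<noteq> w" "b \<noteq> w" "u \<noteq> w" "v \<noteq> w" using V wV uv by auto
  note degi = degree_in_insert[OF V(2) tS]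
  have 1: "0 < det2 (y i) (y j) \<and>
      int (card (matchings (insert w V - {i, j}) (insert {u, w, v} S))) = det2 (y i) (y j)"
    if ij: "i \<in> insert w V" "j \<in> insert w V" "i < j" for i j
  proof -
    consider "i = w" "j \<in> V" | "j = w" "i \<in> V" | "i \<in> V" "j \<in> V" using ij by auto
    then show ?thesis
    proof cases
      case 1
      \<comment> \<open>Both \<open>u\<close> and \<open>v\<close> are at most \<open>j\<close>, so
        the summands have the right orientation; for \<open>j = v\<close> the second one
        vanishes.\<close>
      then have "v \<le> j" using sep[OF 1(2)] ij w by auto
      then have uj: "u < j" using uv by simp
      have sw: "insert w V - {i, j} = insert w V - {j, w}" using 1 by auto
      have "int (card (matchings (insert w V - {i, j}) (insert {u, w, v} S))) =
          det2 (x u) (x j) + det2 (x v) (x j)"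
        unfolding sw using card_matchings_ear_new[OF V(1-3) wV 1(2) uv(1,2)] uv(3)
          match[OF uv(1) 1(2) uj] match[OF uv(2) 1(2)] \<open>v \<le> j\<close>
        by (auto simp: insert_commute det2_self)
      moreover have "0 < det2 (x u) (x j)" "0 \<le> det2 (x v) (x j)"
        using pos[OF uv(1) 1(2) uj] pos[OF uv(2) 1(2)] \<open>v \<le> j\<close>
        by (auto simp: det2_self order_le_less)
      moreover have "j \<noteq> w" using 1 wV by auto
      ultimately show ?thesis using 1 by (simp add: yw yV det2_add)
    next
      case 2
      then have "i \<le> u" using sep[OF 2(2)] ij w by auto
      then have iv: "i < v" using uv by simp
      have "int (card (matchings (insert w V - {i, j}) (insert {u, w, v} S))) =
          det2 (x i) (x u) + det2 (x i) (x v)"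
        unfolding 2(1) using card_matchings_ear_new[OF V(1-3) wV 2(2) uv(1,2)] uv(3)
          match[OF 2(2) uv(2) iv] match[OF 2(2) uv(1)] \<open>i \<le> u\<close>
        by (auto simp: det2_self)
      moreover have "0 < det2 (x i) (x v)" "0 \<le> det2 (x i) (x u)"
        using pos[OF 2(2) uv(2) iv] pos[OF 2(2) uv(1)] \<open>i \<le> u\<close>
        by (auto simp: det2_self order_le_less)
      moreover have "i \<noteq> w" using 2 wV by auto
      ultimately show ?thesis using 2 by (simp add: yw yV det2_add)
    next
      case 3
      then have "i \<noteq> w" "j \<noteq> w" using wV by auto
      then show ?thesis
        using card_matchings_ear_old[OF V(1-3) wV 3] pos[OF 3 ij(3)] match[OF 3 ij(3)]
        by (simp add: yV)
    qed
  qed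
  have 2: "det2 (y i) (y j) = 1" if "consecutive (insert w V) i j" for i j
    using that unfolding cons
    by (auto simp: yw yV cV aw det2_add det2_self one c)
  have 3: "det2 (y i) (y k) = int (degree_in (insert {u, w, v} S) j)"
    if ij: "consecutive (insert w V) i j" and jk: "consecutive (insert w V) j k" for i j k
  proof -
    consider "i = u" "j = w" | "i = w" "j = v" | "consecutive V i j" "(i, j) \<noteq> (u, v)"
      using ij unfolding cons by blast
    then show ?thesis
    proof cases
      case 1
      then have "k = v" using jk cV(3)[of w k] aw unfolding cons by blast
      then show ?thesis using 1 aw by (simp add: yV one[OF c] degi degree_in_isolated[OF wS])
    next
      case 2
      then have "consecutive V v k" using jk aw uv unfolding cons by auto
      then show ?thesis using 2 deg[OF c] cV one[of v k] by (simp add: yw yV det2_add degi)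
    next
      case 3
      then have jv: "j \<noteq> v" "j \<noteq> w" using consecutive_unique(2)[OF c] cV by auto
      show ?thesis
      proof (cases "j = u")
        case True
        then have "k = w" using jk aw consecutive_unique(1)[OF c] unfolding cons by auto
        then show ?thesis using True 3 deg[OF _ c] cV one[of i u] by (simp add: yw yV det2_add degi)
      next
        case False
        then have "consecutive V j k" using jk jv unfolding cons by auto
        then show ?thesis using 3 False jv cV deg by (simp add: yV degi)
      qed
    qed
  qed
  have 4: "det2 (y k) (y b) = int (degree_in (insert {u, w, v} S) a)"
    if "consecutive (insert w V) a k" for k
  proof (cases "a = u")
    case True
    then have "k = w" using that aw consecutive_unique(1)[OF c] unfolding cons by auto
    \<comment> \<open>The other neighbour of \<open>a\<close> lies across the closing side, so the
      increment is \<open>det2 (x a) (x b) = 1\<close>.\<close>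
    then show ?thesis using True aw deg_a[of v] c ab by (simp add: yw yV det2_add degi)
  next
    case False
    then have "consecutive V a k" using that aw unfolding cons by auto
    moreover have "a \<noteq> v" using uv V(7) by auto
    ultimately show ?thesis using False aw deg_a[of k] cV by (simp add: yV degi)
  qed
  have 5: "det2 (y a) (y k) = int (degree_in (insert {u, w, v} S) b)"
    if "consecutive (insert w V) k b" for k
  proof (cases "b = v")
    case True
    then have "k = w" using that aw consecutive_unique(2)[OF c] unfolding cons by auto
    then show ?thesis using True aw deg_b[of u] c ab by (simp add: yw yV det2_add degi)
  next
    case False
    then have "consecutive V k b" using that aw unfolding cons by auto
    moreover have "b \<noteq> u" using uv V(7) by auto
    ultimately show ?thesis using False aw deg_b[of k] cV by (simp add: yV degi)
  qed
  show ?thesis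
    unfolding frieze_vectors_def y_def[symmetric]
    using 1 2 3 4 5 ab aw by (simp add: yV)
qed

text \<open>The empty relation is the only matching of the 2-gon. Each end has the other as
  neighbour on both sides, so the degree conditions reduce to \<open>det2 p p = 0\<close>.\<close>

lemma frieze_vectors_base:
  assumes "a < b"
  shows "frieze_vectors a b {a, b} {} (\<lambda>i. if i = a then (1, 0) else (0, 1))"
proof -
  have "matchings {} {} = {{}}" by (auto simp: matchings_def)
  moreover have "{a, b} - {a, b} = {}" by simp
  ultimately show ?thesis using assms
    by (auto simp: frieze_vectors_def consecutive_def det2_def degree_in_def)
qed

lemma frieze_vectors_exist:
  assumes "ear_built a b V S"
  shows "\<exists>x. frieze_vectors a b V S x"
  using assms
proof (induction rule: ear_built.induct)
  case base
  then show ?case using frieze_vectors_base by blast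
next
  case (ear V S u v w)
  then show ?case using frieze_vectors_ear by blast
qed

section \<open>From triangulations to friezes\<close>

lemma label_in_range: "k \<in> {1..int n} \<Longrightarrow> label n k = k"
  by (auto simp: label_def)

lemma sides_eq:
  assumes "n \<ge> 3"
  shows "sides n = insert {1, int n} {{k, k + 1} | k. 1 \<le> k \<and> k < int n}"
proof -
  have last: "label n (int n + 1) = 1" using assms by (simp add: label_def)
  have "{k, label n (k + 1)} = (if k < int n then {k, k + 1} else {1, int n})"
    if "k \<in> {1..int n}" for k
    using that last label_in_range[of "k + 1" n] by (cases "k < int n") auto
  then have "sides n = {if k < int n then {k, k + 1} else {1, int n} | k. k \<in> {1..int n}}"
    unfolding sides_def vertices_def by (metis (no_types, lifting))
  also have "\<dots> = insert {1, int n} {{k, k + 1} | k. 1 \<le> k \<and> k < int n}" (is "?L = ?R")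
  proof (intro equalityI subsetI)
    fix e assume "e \<in> ?R"
    then consider "e = {1, int n}" | k where "e = {k, k + 1}" "1 \<le> k" "k < int n" by blast
    then show "e \<in> ?L"
    proof cases
      case 1
      then show ?thesis using assms by (intro CollectI exI[of _ "int n"]) auto
    next
      case 2
      then show ?thesis by (intro CollectI exI[of _ k]) auto
    qed
  qed (auto split: if_splits)
  finally show ?thesis .
qed

lemma consecutive_interval:
  "consecutive {1..int n} i j \<longleftrightarrow> 1 \<le> i \<and> j \<le> int n \<and> j = i + 1"
proof
  assume "consecutive {1..int n} i j"
  then have ij: "1 \<le> i" "j \<le> int n" "i < j" and sep: "\<forall>z\<in>{1..int n}. z \<le> i \<or> j \<le> z"
    unfolding consecutive_def by auto
  have "i + 1 \<in> {1..int n}" using ij by auto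
  then have "i + 1 \<le> i \<or> j \<le> i + 1" using sep by blast
  then show "1 \<le> i \<and> j \<le> int n \<and> j = i + 1" using ij by simp
qed (auto simp: consecutive_def)

lemma ear_built_triangulation:
  assumes n: "n \<ge> 3" and T: "triangulation n T"
  shows "ear_built 1 (int n) {1..int n} (triangles n T)"
proof -
  define D where "D = {(i, j). i < j \<and> {i, j} \<in> T}"
  \<comment> \<open>Counting the closing side as a chord raises \<open>n - 3\<close> to
    \<open>n - 2\<close>, the number at which the bound for noncrossing arcs is attained.\<close>
  define C where "C = insert (1, int n) D"
  have T': "T \<subseteq> diagonals n" "card T = n - 3" "\<And>e f. e \<in> T \<Longrightarrow> f \<in> T \<Longrightarrow> \<not> crossing e f"
    using T by (auto simp: triangulation_def)
  have D: "1 \<le> i" "j \<le> int n" "i < j" "j \<noteq> i + 1" "(i, j) \<noteq> (1, int n)" if "(i, j) \<in> D" for i j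
  proof -
    have ij: "i < j" "{i, j} \<subseteq> {1..int n}" "{i, j} \<notin> sides n"
      using that T'(1) by (auto simp: D_def diagonals_def vertices_def)
    then show "1 \<le> i" "j \<le> int n" "i < j" by auto
    then show "j \<noteq> i + 1" "(i, j) \<noteq> (1, int n)"
      using ij(3) unfolding sides_eq[OF n] by auto
  qed
  have "bij_betw (\<lambda>(i, j). {i, j}) D T"
  proof (rule bij_betwI')
    fix p q assume "p \<in> D" "q \<in> D"
    then show "((case p of (i, j) \<Rightarrow> {i, j}) = (case q of (i, j) \<Rightarrow> {i, j})) = (p = q)"
      by (auto simp: D_def doubleton_eq_iff)
  next
    fix e assume e: "e \<in> T"
    then have "card e = 2" using T'(1) by (auto simp: diagonals_def)
    then obtain x y where xy: "e = {x, y}" "x \<noteq> y" by (meson card_2_iff)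
    show "\<exists>p\<in>D. e = (case p of (i, j) \<Rightarrow> {i, j})"
    proof (cases "x < y")
      case True
      then show ?thesis using xy e by (intro bexI[of _ "(x, y)"]) (auto simp: D_def)
    next
      case False
      then show ?thesis using xy e by (intro bexI[of _ "(y, x)"]) (auto simp: D_def insert_commute)
    qed
  qed (auto simp: D_def)
  then have "card D = n - 3" using T'(2) bij_betw_same_card by metis
  moreover have "finite D"
    by (rule finite_subset[of _ "{1..int n} \<times> {1..int n}"]) (use D in force)+
  moreover have "(1, int n) \<notin> D" using D(5) by blast
  ultimately have "card C + 2 = card {1..int n}" using n by (simp add: C_def)
  moreover have "C \<subseteq> arcs {1..int n}"
  proof -
    have "(i, j) \<in> arcs {1..int n}" if "1 \<le> i" "j \<le> int n" "i < j" "j \<noteq> i + 1" for i j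
    proof -
      have "i + 1 \<in> {1..int n} \<inter> {i<..<j}" using that by auto
      then have "{1..int n} \<inter> {i<..<j} \<noteq> {}" by blast
      then show ?thesis using that by (simp add: arcs_def)
    qed
    then show ?thesis using D n unfolding C_def by auto
  qed
  moreover have "noncrossing C"
    unfolding noncrossing_def
  proof (intro allI impI notI)
    fix a b c d assume ac: "(a, c) \<in> C" and bd: "(b, d) \<in> C" and lt: "a < b \<and> b < c \<and> c < d"
    have "1 \<le> a" "d \<le> int n" using ac bd D n unfolding C_def by auto
    \<comment> \<open>The closing pair takes part in no crossing: alternation would need an endpoint
      below 1 or above \<open>n\<close>.\<close>
    then have "(a, c) \<in> D" "(b, d) \<in> D" using ac bd lt unfolding C_def by auto
    then have "{a, c} \<in> T" "{b, d} \<in> T" by (auto simp: D_def)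
    moreover have "crossing {a, c} {b, d}" unfolding crossing_def using lt by blast
    ultimately show False using T'(3) by blast
  qed
  ultimately have "ear_built 1 (int n) {1..int n} (cliques3 {1..int n} (arc_edges {1..int n} C))"
    using n by (intro ear_built_cliques3) auto
  moreover have "arc_edges {1..int n} C = sides n \<union> T"
  proof -
    have "consecutive {1..int n} i j \<longleftrightarrow> (\<exists>k. 1 \<le> k \<and> k < int n \<and> i = k \<and> j = k + 1)" for i j
      by (auto simp: consecutive_interval)
    then have "arc_edges {1..int n} C = {{i, j} | i j. (i, j) \<in> D} \<union>
        insert {1, int n} {{k, k + 1} | k. 1 \<le> k \<and> k < int n}"
      unfolding arc_edges_def C_def by auto
    also have "{{i, j} | i j. (i, j) \<in> D} = T"
      using bij_betw_imp_surj_on[OF \<open>bij_betw (\<lambda>(i, j). {i, j}) D T\<close>] by auto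
    finally show ?thesis unfolding sides_eq[OF n] by auto
  qed
  ultimately show ?thesis by (simp add: cliques3_def triangles_def vertices_def)
qed

lemma num_matchings_eq:
  "num_matchings n T i j = card (matchings ({1..int n} - {label n i, label n j}) (triangles n T))"
proof -
  let ?B = "{1..int n} - {label n i, label n j}"
  have "reduced_graph n T i j = (Inl ` ?B \<union> Inr ` triangles n T,
      {{Inl v, Inr t} | v t. v \<in> ?B \<and> t \<in> triangles n T \<and> v \<in> t})"
    unfolding reduced_graph_def delete_vertices_def incidence_graph_def vertices_def
    by auto
  then show ?thesis unfolding num_matchings_def
    using card_perfect_matchings[of ?B "triangles n T"] by metis
qed

text \<open>The sign change per period makes \<open>det2\<close> positive also across the end of a period.\<close>

definition periodic_vector :: "nat \<Rightarrow> (int \<Rightarrow> int \<times> int) \<Rightarrow> int \<Rightarrow> int \<times> int" where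
  "periodic_vector n x k = (if even ((k - 1) div int n) then x (label n k) else - x (label n k))"

text \<open>As \<open>j - i\<close> is less than \<open>n\<close>, at most one period boundary
  separates \<open>i\<close> and \<open>j\<close>. Passing it reverses the order of the labels and
  flips one sign, which antisymmetry of the determinant absorbs.\<close>

lemma det2_periodic_vector:
  assumes "n \<ge> 3" "1 \<le> j - i" "j - i \<le> int n - 1"
  shows "label n i < label n j \<Longrightarrow>
      det2 (periodic_vector n x i) (periodic_vector n x j) = det2 (x (label n i)) (x (label n j))"
    and "label n i > label n j \<Longrightarrow>
      det2 (periodic_vector n x i) (periodic_vector n x j) = det2 (x (label n j)) (x (label n i))"
    and "label n j = label n i + (j - i) \<or> label n j = label n i + (j - i) - int n"
proof -
  define q r where "q = (i - 1) div int n" and "r = (i - 1) mod int n"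
  have r: "0 \<le> r" "r < int n" using assms by (simp_all add: r_def)
  have i: "i - 1 = r + q * int n" by (simp add: q_def r_def)
  \<comment> \<open>The unreduced position of \<open>j\<close> within the period of
    \<open>i\<close>; comparing it with \<open>n\<close> tells whether the boundary is
    passed.\<close>
  define s where "s = r + (j - i)"
  have j: "j - 1 = s + q * int n" using i by (simp add: s_def)
  have li: "label n i = r + 1" by (simp add: label_def r_def)
  have "label n j = s + 1 \<and> (j - 1) div int n = q \<or>
      label n j = s - int n + 1 \<and> (j - 1) div int n = q + 1"
  proof (cases "s < int n")
    case True
    then show ?thesis using r assms unfolding label_def j by (simp add: s_def)
  next
    case False
    have j': "j - 1 = (s - int n) + (q + 1) * int n" using j by (simp add: algebra_simps)
    have "0 \<le> s - int n" "s - int n < int n" using False r assms by (simp_all add: s_def)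
    then have "(s - int n) mod int n = s - int n" "(s - int n) div int n = 0"
      by (rule mod_pos_pos_trivial, rule div_pos_pos_trivial)
    then show ?thesis using assms div_mult_self1[of "int n" "s - int n" "q + 1"]
      unfolding label_def j' by simp
  qed
  then have *: "label n j = s + 1 \<and> (j - 1) div int n = q \<and> label n i < label n j \<or>
      label n j = s - int n + 1 \<and> (j - 1) div int n = q + 1 \<and> label n j < label n i"
    using li assms by (auto simp: s_def)
  show "label n j = label n i + (j - i) \<or> label n j = label n i + (j - i) - int n"
    using * li by (auto simp: s_def)
  show "det2 (periodic_vector n x i) (periodic_vector n x j) = det2 (x (label n i)) (x (label n j))"
    if "label n i < label n j"
    using * that by (auto simp: periodic_vector_def det2_def q_def[symmetric])
  show "det2 (periodic_vector n x i) (periodic_vector n x j) = det2 (x (label n j)) (x (label n i))"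
    if "label n i > label n j"
    using * that by (auto simp: periodic_vector_def det2_def q_def[symmetric])
qed

lemma frieze_row_det2:
  assumes one: "\<And>i. det2 (X i) (X (i + 1)) = 1"
    and deg: "\<And>i. det2 (X i) (X (i + 2)) = int (num_incident n T (i + 1))"
    and nz: "\<And>i r. 1 \<le> r \<Longrightarrow> r < n \<Longrightarrow> det2 (X i) (X (i + int r)) \<noteq> 0"
    and r: "1 \<le> r" "r < n"
  shows "frieze_row n T r i = of_int (det2 (X i) (X (i + int r)))"
  using r
proof (induction r arbitrary: i rule: less_induct)
  case (less r)
  consider "r = 1" | "r = 2" | s where "r = Suc (Suc (Suc s))"
    using less.prems(1) by (metis One_nat_def Suc_1 not0_implies_Suc not_one_le_zero)
  then show ?case
  proof cases
    case 1
    then show ?thesis using one by simp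
  next
    case 2
    then show ?thesis using deg by (simp add: numeral_2_eq_2)
  next
    case 3
    have ih: "frieze_row n T k i = of_int (det2 (X i) (X (i + int k)))"
      if "k \<in> {Suc s, Suc (Suc s)}" for k i
      using that less.prems 3 by (intro less.IH) auto
    \<comment> \<open>With this shift the four indices form two adjacent pairs, \<open>i\<close>,
      \<open>i + 1\<close> and \<open>m + 2\<close>, \<open>m + 3\<close>, whose determinants are
      1.\<close>
    define m where "m = i + int s"
    have e: "i + int (Suc (Suc s)) = m + 2" "i + 1 + int (Suc (Suc s)) = m + 3"
      "i + 1 + int (Suc s) = m + 2" "i + int r = m + 3"
      by (simp_all add: m_def 3)
    have "det2 (X i) (X (m + 2)) * det2 (X (i + 1)) (X (m + 3)) =
        det2 (X i) (X (i + 1)) * det2 (X (m + 2)) (X (m + 3)) +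
        det2 (X i) (X (m + 3)) * det2 (X (i + 1)) (X (m + 2))"
      by (rule det2_pluecker)
    also have "\<dots> = 1 + det2 (X i) (X (m + 3)) * det2 (X (i + 1)) (X (m + 2))"
      using one[of i] one[of "m + 2"] by (simp add: add.assoc)
    finally have "det2 (X i) (X (m + 2)) * det2 (X (i + 1)) (X (m + 3)) - 1 =
        det2 (X i) (X (m + 3)) * det2 (X (i + 1)) (X (m + 2))" by simp
    then have "(of_int (det2 (X i) (X (m + 2))) * of_int (det2 (X (i + 1)) (X (m + 3))) - 1 :: rat) =
        of_int (det2 (X i) (X (m + 3))) * of_int (det2 (X (i + 1)) (X (m + 2)))"
      by (metis of_int_1 of_int_diff of_int_mult)
    moreover have "det2 (X (i + 1)) (X (m + 2)) \<noteq> 0"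
      using nz[of "Suc s" "i + 1"] less.prems 3 unfolding e(3) by simp
    ultimately show ?thesis unfolding e(4) unfolding 3 by (simp add: ih e del: of_nat_Suc)
  qed
qed

theorem theorem2p1:
  fixes n :: nat and T :: "int set set" and i j :: int
  assumes "n \<ge> 3"
    and "triangulation n T"
    and "1 \<le> j - i" and "j - i \<le> int n - 1"
  shows "frieze n T i j = of_nat (num_matchings n T i j)"
proof -
  note n = assms(1)
  let ?V = "{1..int n}" and ?S = "triangles n T"
  obtain x where "frieze_vectors 1 (int n) ?V ?S x"
    using frieze_vectors_exist ear_built_triangulation assms(1,2) by blast
  then have pos: "\<And>i j. i \<in> ?V \<Longrightarrow> j \<in> ?V \<Longrightarrow> i < j \<Longrightarrow> 0 < det2 (x i) (x j)"
    and match: "\<And>i j. i \<in> ?V \<Longrightarrow> j \<in> ?V \<Longrightarrow> i < j \<Longrightarrow>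
      int (card (matchings (?V - {i, j}) ?S)) = det2 (x i) (x j)"
    and one: "\<And>i. 1 \<le> i \<Longrightarrow> i + 1 \<le> int n \<Longrightarrow> det2 (x i) (x (i + 1)) = 1"
    and one_n: "det2 (x 1) (x (int n)) = 1"
    and deg: "\<And>i. 1 \<le> i \<Longrightarrow> i + 2 \<le> int n \<Longrightarrow> det2 (x i) (x (i + 2)) = int (degree_in ?S (i + 1))"
    and deg_1: "det2 (x 2) (x (int n)) = int (degree_in ?S 1)"
    and deg_n: "det2 (x 1) (x (int n - 1)) = int (degree_in ?S (int n))"
    using n unfolding frieze_vectors_def consecutive_interval by (auto simp: add.commute)
  define X where "X = periodic_vector n x"
  have label: "label n k \<in> ?V" for k
  proof -
    have "0 \<le> (k - 1) mod int n" "(k - 1) mod int n < int n" using n by simp_all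
    then show ?thesis unfolding label_def atLeastAtMost_iff by linarith
  qed
  note per = det2_periodic_vector(1,2)[OF n, where x = x, folded X_def]
    det2_periodic_vector(3)[OF n]
  have X: "0 < det2 (X i) (X j) \<and> int (num_matchings n T i j) = det2 (X i) (X j)"
    if ij: "1 \<le> j - i" "j - i \<le> int n - 1" for i j
  proof (cases "label n i < label n j")
    case True
    then show ?thesis using pos match label per(1)[OF ij True] by (simp add: num_matchings_eq)
  next
    case False
    \<comment> \<open>Equal labels would force \<open>j - i\<close> to be 0 or
      \<open>n\<close>.\<close>
    then have gt: "label n j < label n i" using per(3)[OF ij] ij by auto
    show ?thesis using gt pos match[OF label label gt] label per(2)[OF ij gt]
      by (simp add: num_matchings_eq insert_commute)
  qed
  have X1: "det2 (X i) (X (i + 1)) = 1" for i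
  proof -
    have d: "1 \<le> (i + 1) - i" "(i + 1) - i \<le> int n - 1" using n by auto
    consider "label n (i + 1) = label n i + 1" | "label n (i + 1) = 1" "label n i = int n"
      using per(3)[OF d] label[of i] label[of "i + 1"] by force
    then show ?thesis
    proof cases
      case 1
      then show ?thesis using per(1)[OF d] one label[of i] label[of "i + 1"] by simp
    next
      case 2
      then show ?thesis using per(2)[OF d] one_n n by simp
    qed
  qed
  have X2: "det2 (X i) (X (i + 2)) = int (num_incident n T (i + 1))" for i
  proof -
    have d: "1 \<le> (i + 2) - i" "(i + 2) - i \<le> int n - 1"
      and d1: "1 \<le> (i + 1) - i" "(i + 1) - i \<le> int n - 1" using n by auto
    \<comment> \<open>The period boundary is absent, or follows \<open>i + 1\<close>, or follows
      \<open>i\<close>. The middle vertex is accordingly interior to the labelling, or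
      \<open>n\<close>, or 1, which selects the matching degree condition.\<close>
    consider "label n (i + 1) = label n i + 1" "label n (i + 2) = label n i + 2"
      | "label n i = int n - 1" "label n (i + 1) = int n" "label n (i + 2) = 1"
      | "label n i = int n" "label n (i + 1) = 1" "label n (i + 2) = 2"
      using per(3)[OF d] per(3)[OF d1] label[of i] label[of "i + 1"] label[of "i + 2"] n by force
    then have "det2 (X i) (X (i + 2)) = int (degree_in ?S (label n (i + 1)))"
    proof cases
      case 1
      then show ?thesis using per(1)[OF d] deg label[of i] label[of "i + 2"] by simp
    next
      case 2
      then show ?thesis using per(2)[OF d] deg_n n by simp
    next
      case 3
      then show ?thesis using per(2)[OF d] deg_1 n by simp
    qed
    then show ?thesis by (simp add: degree_in_def num_incident_def)
  qed
  have "frieze n T i j = of_int (det2 (X i) (X (i + int (nat (j - i)))))"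
    unfolding frieze_def
  proof (rule frieze_row_det2[OF X1 X2])
    \<comment> \<open>Strict positivity was carried through the ear construction for this purpose:
      it keeps every divisor of the recurrence nonzero.\<close>
    show "det2 (X k) (X (k + int r)) \<noteq> 0" if "1 \<le> r" "r < n" for k r
      using X[of "k + int r" k] that by auto
  qed (use assms in auto)
  also have "\<dots> = of_int (int (num_matchings n T i j))"
    using X[OF assms(3,4)] assms(3) by simp
  finally show ?thesis by simp
qed

end
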